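(* Let $\theta$ and $\vartheta$ be random variables with values in $S^1$, and let $P$ be a polynomial with $P(x_1,x_2)=\sum_{k_1,k_2=0}^{\infty}b_{k_1,k_2}x_1^{k_1}x_2^{k_2}$. Put $\alpha_{k_1,k_2}:=\mathbb{E}[\theta^{k_1}\vartheta^{k_2}]$. Then for $n\ge 2$, $$\mathbb{E}_{\mathcal{A}_n}\left[W^1(P)(x_1,x_2)\right]=\left[\prod_{k_1,k_2=0}^\infty(1-x_1^{k_1}x_2^{k_2}t)^{-b_{k_1,k_2}\alpha_{k_1,k_2}}\right]_n+\left[\prod_{k_1,k_2=0}^\infty(1+x_1^{k_1}x_2^{k_2}t)^{-b_{k_1,k_2}\alpha_{k_1,k_2}}\right]_n,$$ $$\mathbb{E}_{\mathcal{A}_n}\left[W^2(P)(x_1,x_2)\right]=\left[\prod_{k_1,k_2=0}^\infty(1-\alpha_{k_1,k_2}x_1^{k_1}x_2^{k_2}t)^{-b_{k_1,k_2}}\right]_n+\left[\prod_{k_1,k_2=0}^\infty(1+\alpha_{k_1,k_2}x_1^{k_1}x_2^{k_2}t)^{-b_{k_1,k_2}}\right]_n.$$ The products in these two formulas are holomorphic for $|t|<1$ and $\max\{|x_1|,|x_2|\}\le 1$.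
   Context: $\mathcal{A}_n\subset\mathcal{S}_n$ is the alternating group of even permutations of $\{1,\dots,n\}$; $\mathcal{C}_\lambda\subset\mathcal{S}_n$ is the set of permutations with cycle-type the partition $\lambda=(\lambda_1,\dots,\lambda_{l(\lambda)})$ of $n$ (the $\lambda_m\geq 1$ are the cycle lengths, $l(\lambda)$ is the number of cycles). For a power series $h(t)=\sum_n h_nt^n$ write $[h(t)]_n:=h_n$. Complex powers $z^s$ are defined with the principal branch of the logarithm on $\mathbb{C}\setminus\mathbb{R}_{\le 0}$. The coefficients $b_{k_1,k_2}$ are complex and only finitely many are non-zero. First randomized class function: for $g\in\mathcal{C}_\lambda$, $W^1(P)(x_1,x_2)(g):=\prod_{m=1}^{l(\lambda)}P(\theta_mx_1^{\lambda_m},\vartheta_mx_2^{\lambda_m})$, where the pairs $(\theta_m,\vartheta_m)$ are iid, distributed as $(\theta,\vartheta)$, and independent of $g$ (one pair per cycle). Second randomized class function: for $g\in\mathcal{C}_\lambda$, $W^2(P)(x_1,x_2)(g):=\prod_{m=1}^{l(\lambda)}P\big(x_1^{\lambda_m}\prod_{i=1}^{\lambda_m}\theta_i^{(m)},\,x_2^{\lambda_m}\prod_{i=1}^{\lambda_m}\vartheta_i^{(m)}\big)$, where the $n$ pairs $(\theta_i^{(m)},\vartheta_i^{(m)})$ are iid, distributed as $(\theta,\vartheta)$, and independent of $g$ (one pair per point). $\mathbb{E}_{\mathcal{A}_n}[\cdot]$ denotes expectation over $g$ uniformly distributed on $\mathcal{A}_n$ (for $n\ge2$: $\frac{2}{n!}\sum_{\sigma\in\mathcal{A}_n}$)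 and over the auxiliary random variables.
   Formalization: The exponents of the two (1+…) products are corrected from −bα and −b to +bα and +b: as printed the formulas fail, e.g. for P=1 the left side is 1 and the right side is 1+(−1)^n. The holomorphy claim refers to the corrected products. *)

theory Defs
  imports
    "HOL-Complex_Analysis.Complex_Analysis"
    "HOL-Probability.Probability"
    "HOL-Combinatorics.Orbits"
    "HOL-Algebra.Sym_Groups"
begin

(* For g permuting {1..n}: the cycle lengths, with multiplicity, in weakly decreasing order.
   The cycles of g are its orbits on {1..n}; fixed points count as cycles of length 1. *)
definition cycle_type :: "nat \<Rightarrow> (nat \<Rightarrow> nat) \<Rightarrow> nat list" where
  "cycle_type n g =
     rev (sorted_list_of_multiset (image_mset card (mset_set (Orbits.orbit g ` {1..n}))))"

definition poly2 :: "(nat \<Rightarrow> nat \<Rightarrow> complex) \<Rightarrow> complex \<Rightarrow> complex \<Rightarrow> complex" where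
  "poly2 b y1 y2 = (\<Sum>(k1, k2) | b k1 k2 \<noteq> 0. b k1 k2 * y1 ^ k1 * y2 ^ k2)"

(* The cycles and the points on a cycle are numbered from 0. The arguments th, vth are the
   values of the auxiliary random variables: one pair per cycle m for W1, and one pair for
   the i-th point of the m-th cycle, indexed by (m, i), for W2. *)
definition W1 :: "(complex \<Rightarrow> complex \<Rightarrow> complex) \<Rightarrow> complex \<Rightarrow> complex \<Rightarrow>
    (nat \<Rightarrow> complex) \<Rightarrow> (nat \<Rightarrow> complex) \<Rightarrow> nat \<Rightarrow> (nat \<Rightarrow> nat) \<Rightarrow> complex" where
  "W1 P x1 x2 th vth n g =
     (let l = cycle_type n g in
      \<Prod>m<length l. P (th m * x1 ^ (l ! m)) (vth m * x2 ^ (l ! m)))"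

definition W2 :: "(complex \<Rightarrow> complex \<Rightarrow> complex) \<Rightarrow> complex \<Rightarrow> complex \<Rightarrow>
    (nat \<times> nat \<Rightarrow> complex) \<Rightarrow> (nat \<times> nat \<Rightarrow> complex) \<Rightarrow> nat \<Rightarrow> (nat \<Rightarrow> nat) \<Rightarrow> complex" where
  "W2 P x1 x2 th vth n g =
     (let l = cycle_type n g in
      \<Prod>m<length l. P (x1 ^ (l ! m) * (\<Prod>i<l ! m. th (m, i)))
                       (x2 ^ (l ! m) * (\<Prod>i<l ! m. vth (m, i))))"

(* On the probability space N, g is uniform on the alternating group, and the pairs
   (th i, vth i), i in I, are iid, distributed as D, and (jointly) independent of g.
   No independence of th i and vth i within a pair is required.
   Independence of g from the family is independence of the generated sigma-algebras,
   because the library's indep_var needs both variables to have the same type. *)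
definition randomization :: "'w measure \<Rightarrow> nat \<Rightarrow> ('w \<Rightarrow> nat \<Rightarrow> nat) \<Rightarrow> 'i set \<Rightarrow>
    (complex \<times> complex) measure \<Rightarrow> ('i \<Rightarrow> 'w \<Rightarrow> complex) \<Rightarrow> ('i \<Rightarrow> 'w \<Rightarrow> complex) \<Rightarrow> bool" where
  "randomization N n g I D th vth \<longleftrightarrow>
     prob_space N \<and>
     g \<in> measurable N (count_space (carrier (alt_group n))) \<and>
     distr N (count_space (carrier (alt_group n))) g =
       uniform_count_measure (carrier (alt_group n)) \<and>
     prob_space.indep_vars N (\<lambda>_. borel) (\<lambda>i \<omega>. (th i \<omega>, vth i \<omega>)) I \<and>
     (\<forall>i\<in>I. distr N borel (\<lambda>\<omega>. (th i \<omega>, vth i \<omega>)) = D) \<and>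
     prob_space.indep_set N
       (sets (vimage_algebra (space N) g (count_space (carrier (alt_group n)))))
       (sets (vimage_algebra (space N) (\<lambda>\<omega>. \<lambda>i\<in>I. (th i \<omega>, vth i \<omega>)) (PiM I (\<lambda>_. borel))))"

(* Holomorphy in three complex variables jointly, on a not necessarily open set S:
   complex Frechet differentiability at each point of some open neighbourhood of S. *)
definition holomorphic3_on ::
    "(complex \<times> complex \<times> complex \<Rightarrow> complex) \<Rightarrow> (complex \<times> complex \<times> complex) set \<Rightarrow> bool" where
  "holomorphic3_on f S \<longleftrightarrow>
     (\<exists>U. open U \<and> S \<subseteq> U \<and>
        (\<forall>z\<in>U. \<exists>D. (f has_derivative D) (at z) \<and>
           (\<forall>c h1 h2 h3. D (c * h1, c * h2, c * h3) = c * D (h1, h2, h3))))"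

end

theory Submission
  imports Defs
begin

text \<open>
  Fix a permutation \<open>p\<close> with cycle lengths \<open>l\<^sub>1, l\<^sub>2, \<dots>\<close>. Expanding \<open>P\<close> into monomials, both
  randomized class functions are products over the cycles of \<open>p\<close> of independent factors, so their
  expectations are products \<open>\<Prod>m. c (l\<^sub>m)\<close> with
  \<open>c l = (\<Sum>k. \<beta> k * y k ^ l)\<close>. With \<open>k = (k1, k2)\<close>, one has \<open>\<beta> k = b k1 k2 * \<alpha> k1 k2\<close> and
  \<open>y k = x1 ^ k1 * x2 ^ k2\<close> for \<open>W1\<close>, and \<open>\<beta> k = b k1 k2\<close> and
  \<open>y k = \<alpha> k1 k2 * x1 ^ k1 * x2 ^ k2\<close> for \<open>W2\<close>
  (\<open>expectation_blocks\<close>, \<open>expectation_randomized_class_function\<close>).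

  Let \<open>z n\<close> be \<open>1 / fact n\<close> times the sum of \<open>\<Prod>m. c (l\<^sub>m)\<close> over all permutations of \<open>n\<close> points.
  Classifying permutations by the length of the cycle through a marked point gives
  \<open>n * z n = (\<Sum>l = 1..n. c l * z (n - l))\<close> (\<open>sum_cycle_weight\<close>). The Taylor coefficients at \<open>0\<close> of
  \<open>f t = (\<Prod>k. (1 - y k * t) powr (- \<beta> k))\<close> obey the same recursion, because
  \<open>f' t = f t * (\<Sum>k. \<beta> k * y k / (1 - y k * t))\<close> (\<open>powr_prod_coeff_recursion\<close>); hence
  they are the numbers \<open>z n\<close>.

  Averaging over the alternating group means averaging \<open>1 + sign p\<close> times the weight over the
  symmetric group. Since \<open>sign p\<close> is the product of \<open>(- 1) ^ (l\<^sub>m + 1)\<close> over the cycles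
  (\<open>sign_eq_cycle_weight\<close>), the signed sum is again of the same form, with \<open>- \<beta>\<close> and \<open>- y\<close> in place
  of \<open>\<beta>\<close> and \<open>y\<close>; this produces the second product (\<open>alt_group_average_cycle_weight\<close>).

  Finally \<open>\<bar>\<alpha> k1 k2\<bar> \<le> 1\<close>, so on the set in question every base \<open>1 \<plusminus> y k * t\<close> has positive real
  part, and the products are holomorphic (\<open>holomorphic3_on_powr_prod\<close>).
\<close>

section \<open>Weighted sums over the permutations of a finite set\<close>

text \<open>
  The cycles of \<open>p\<close> on \<open>S\<close>, as sets of points; fixed points give singletons. This is meant for
  permutations \<open>p\<close> of \<open>S\<close>.
\<close>

definition perm_cycles :: "('a \<Rightarrow> 'a) \<Rightarrow> 'a set \<Rightarrow> 'a set set" where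
  "perm_cycles p S = Orbits.orbit p ` S"

text \<open>
  The multiplicative class function that gives each cycle of length \<open>m\<close> the weight \<open>c m\<close>.
\<close>

definition cycle_weight :: "(nat \<Rightarrow> 'b::comm_monoid_mult) \<Rightarrow> ('a \<Rightarrow> 'a) \<Rightarrow> 'a set \<Rightarrow> 'b" where
  "cycle_weight c p S = (\<Prod>C\<in>perm_cycles p S. c (card C))"

text \<open>
  The same weight, except that the cycle through the marked point \<open>a\<close> is weighted by \<open>f\<close> instead
  of \<open>c\<close>. Letting \<open>f\<close> vary is what makes the induction in \<open>sum_marked_weight\<close> work.
\<close>

definition marked_weight ::
    "(nat \<Rightarrow> 'b::comm_monoid_mult) \<Rightarrow> (nat \<Rightarrow> 'b) \<Rightarrow> ('a \<Rightarrow> 'a) \<Rightarrow> 'a set \<Rightarrow> 'a \<Rightarrow> 'b" where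
  "marked_weight f c p S a =
     f (card (Orbits.orbit p a)) * (\<Prod>C\<in>perm_cycles p S - {Orbits.orbit p a}. c (card C))"

lemma finite_perm_cycles: "finite S \<Longrightarrow> finite (perm_cycles p S)"
  by (simp add: perm_cycles_def)

lemma cycle_weight_marked:
  assumes "finite S" "a \<in> S"
  shows "cycle_weight c p S = marked_weight c c p S a"
  unfolding cycle_weight_def marked_weight_def
  by (rule prod.remove) (use assms in \<open>auto simp: perm_cycles_def\<close>)

lemma permutes_self_in_orbit:
  assumes "p permutes S" "finite S"
  shows "x \<in> Orbits.orbit p x"
  using assms permutation_permutes permutation_self_in_orbit by metis

lemma permutes_orbit_eq:
  assumes "p permutes S" "finite S" "y \<in> Orbits.orbit p x"
  shows "Orbits.orbit p y = Orbits.orbit p x"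
  using cyclic_on_orbit[OF assms(1,2)] assms(3) by (rule orbit_cyclic_eq3)

lemma permutes_insert_point:
  assumes "p permutes S" "b \<in> insert x S"
  shows "Transposition.transpose x b \<circ> p permutes insert x S"
  by (intro permutes_compose permutes_swap_id permutes_imp_permutes_insert) (use assms in auto)

text \<open>
  Composing with the transposition of a new point \<open>x\<close> and \<open>b \<in> S\<close> inserts \<open>x\<close> immediately
  before \<open>b\<close> in the cycle of \<open>b\<close> and leaves the other cycles alone.
\<close>

lemma orbit_insert_point:
  assumes p: "p permutes S" "finite S" and x: "x \<notin> S" and b: "b \<in> S"
  shows "Orbits.orbit (Transposition.transpose x b \<circ> p) x = insert x (Orbits.orbit p b)"
    and "y \<in> S \<Longrightarrow> y \<notin> Orbits.orbit p b \<Longrightarrow> Orbits.orbit (Transposition.transpose x b \<circ> p) y = Orbits.orbit p y"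
proof -
  let ?s = "Transposition.transpose x b \<circ> p"
  have px: "p x = x"
    using p x by (simp add: permutes_def)
  have s_x: "?s x = b"
    using px by simp
  have s_b: "?s y = x" if "p y = b" for y
    using that by simp
  have s_other: "?s y = p y" if "y \<in> S" "p y \<noteq> b" for y
    using that permutes_in_image[OF p(1), of y] x by (auto simp: Transposition.transpose_def)
  have s_perm: "?s permutes insert x S"
    by (rule permutes_insert_point[OF p(1)]) (use b in simp)
  have sub: "Orbits.orbit p b \<subseteq> S"
    by (rule permutes_orbit_subset[OF p(1) b])
  show "Orbits.orbit ?s x = insert x (Orbits.orbit p b)"
  proof
    show "Orbits.orbit ?s x \<subseteq> insert x (Orbits.orbit p b)"
    proof
      fix y assume "y \<in> Orbits.orbit ?s x"
      then show "y \<in> insert x (Orbits.orbit p b)"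
      proof induction
        case base
        then show ?case
          using s_x permutes_self_in_orbit[OF p] by simp
      next
        case (step y)
        show ?case
        proof (cases "y = x")
          case True
          then show ?thesis
            using s_x permutes_self_in_orbit[OF p] by simp
        next
          case False
          then have "y \<in> Orbits.orbit p b" using step by simp
          then have "p y \<in> Orbits.orbit p b" "y \<in> S"
            using sub by (auto intro: orbit.step)
          then show ?thesis
            using s_b[of y] s_other[of y] by (cases "p y = b") auto
        qed
      qed
    qed
    have b_in: "b \<in> Orbits.orbit ?s x"
      using orbit.base[of ?s x] s_x by simp
    have p_in: "p y \<in> Orbits.orbit ?s x" if "y \<in> S" "y \<in> Orbits.orbit ?s x" for y
      using b_in that s_other[of y] orbit.step[of y ?s x] by (cases "p y = b") auto
    have "y \<in> Orbits.orbit ?s x" if "y \<in> Orbits.orbit p b" for y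
      using that
    proof induction
      case base
      then show ?case using p_in b b_in by blast
    next
      case (step y)
      then show ?case using sub p_in by blast
    qed
    moreover have "x \<in> Orbits.orbit ?s x"
      by (rule permutes_self_in_orbit[OF s_perm]) (use p in simp)
    ultimately show "insert x (Orbits.orbit p b) \<subseteq> Orbits.orbit ?s x"
      by blast
  qed
  assume y: "y \<in> S" "y \<notin> Orbits.orbit p b"
  show "Orbits.orbit ?s y = Orbits.orbit p y"
  proof (rule orbit_cong)
    show "y \<in> Orbits.orbit p y"
      by (rule permutes_self_in_orbit[OF p])
  next
    fix s assume s: "s \<in> Orbits.orbit p y"
    have "p s \<noteq> b"
    proof
      assume "p s = b"
      then have "b \<in> Orbits.orbit p y"
        using s orbit.step by metis
      then have "Orbits.orbit p b = Orbits.orbit p y"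
        by (rule permutes_orbit_eq[OF p])
      then show False
        using y permutes_self_in_orbit[OF p, of y] by simp
    qed
    moreover have "s \<in> S"
      using permutes_orbit_subset[OF p(1) y(1)] s by blast
    ultimately show "?s s = p s"
      by (rule s_other[rotated])
  qed
qed

lemma perm_cycles_insert_point:
  assumes p: "p permutes S" "finite S" and x: "x \<notin> S" and b: "b \<in> S"
  shows "perm_cycles (Transposition.transpose x b \<circ> p) (insert x S) =
    insert (insert x (Orbits.orbit p b)) (perm_cycles p S - {Orbits.orbit p b})"
proof -
  let ?s = "Transposition.transpose x b \<circ> p"
  let ?B = "Orbits.orbit p b"
  have s_perm: "?s permutes insert x S"
    by (rule permutes_insert_point[OF p(1)]) (use b in simp)
  have sub: "?B \<subseteq> S"
    by (rule permutes_orbit_subset[OF p(1) b])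
  have in_B: "Orbits.orbit ?s y = insert x ?B" if "y \<in> insert x ?B" for y
    using permutes_orbit_eq[OF s_perm, of y x] that orbit_insert_point(1)[OF p x b] p by simp
  have "perm_cycles ?s (insert x S) = Orbits.orbit ?s ` (insert x ?B \<union> (S - ?B))"
    unfolding perm_cycles_def using sub by (intro arg_cong2[where f = image]) auto
  also have "\<dots> = insert (insert x ?B) (Orbits.orbit ?s ` (S - ?B))"
    unfolding image_Un using in_B by auto
  also have "Orbits.orbit ?s ` (S - ?B) = Orbits.orbit p ` (S - ?B)"
    using orbit_insert_point(2)[OF p x b] by (intro image_cong) auto
  also have "\<dots> = perm_cycles p S - {?B}"
    unfolding perm_cycles_def
    using permutes_orbit_eq[OF p, of _ b] permutes_self_in_orbit[OF p] by blast
  finally show ?thesis .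
qed

lemma perm_cycles_insert_fixed:
  assumes "p permutes S" "x \<notin> S"
  shows "perm_cycles p (insert x S) = insert {x} (perm_cycles p S)"
proof -
  have "Orbits.orbit p x = {x}"
    using assms by (simp add: orbit_eq_singleton_iff permutes_def)
  then show ?thesis by (simp add: perm_cycles_def)
qed

lemma perm_cycles_subset:
  assumes "p permutes S" "C \<in> perm_cycles p S"
  shows "C \<subseteq> S"
  using assms permutes_orbit_subset by (fastforce simp: perm_cycles_def)

lemma marked_weight_insert_point:
  assumes p: "p permutes S" "finite S" and x: "x \<notin> S" and b: "b \<in> S"
  shows "marked_weight f c (Transposition.transpose x b \<circ> p) (insert x S) x =
    marked_weight (\<lambda>m. f (Suc m)) c p S b"
proof -
  have sub: "Orbits.orbit p b \<subseteq> S"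
    by (rule permutes_orbit_subset[OF p(1) b])
  then have "card (insert x (Orbits.orbit p b)) = Suc (card (Orbits.orbit p b))"
    using x p(2) finite_subset by (subst card_insert_disjoint) auto
  moreover have "insert x (Orbits.orbit p b) \<notin> perm_cycles p S"
    using perm_cycles_subset[OF p(1)] x by blast
  ultimately show ?thesis
    unfolding marked_weight_def orbit_insert_point(1)[OF p x b] perm_cycles_insert_point[OF p x b]
    by simp
qed

lemma marked_weight_insert_fixed:
  assumes p: "p permutes S" and x: "x \<notin> S"
  shows "marked_weight f c p (insert x S) x = f 1 * cycle_weight c p S"
proof -
  have "Orbits.orbit p x = {x}"
    using assms by (simp add: orbit_eq_singleton_iff permutes_def)
  moreover have "{x} \<notin> perm_cycles p S"
    using perm_cycles_subset[OF p] x by blast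
  ultimately show ?thesis
    unfolding marked_weight_def cycle_weight_def perm_cycles_insert_fixed[OF p x] by simp
qed

text \<open>
  The sum over all permutations of \<open>Suc n\<close> points, sorted by the length \<open>Suc m\<close> of the marked cycle:
  there are \<open>fact n / fact (n - m)\<close> choices of that cycle, and the permutations of the remaining
  \<open>n - m\<close> points contribute \<open>fact (n - m) * z (n - m)\<close>. In the induction the marked point is the
  one that is inserted last. If it is inserted as a fixed point, it contributes \<open>f 1\<close>; if it is
  inserted before \<open>b\<close>, the mark passes to \<open>b\<close> and \<open>f\<close> is shifted by one.
\<close>

lemma sum_marked_weight:
  fixes c z :: "nat \<Rightarrow> 'b::{comm_ring_1, ring_char_0}"
  assumes z0: "z 0 = 1"
    and z_Suc: "\<And>n. of_nat (Suc n) * z (Suc n) = (\<Sum>m\<le>n. c (Suc m) * z (n - m))"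
    and S: "finite S" "a \<in> S" "card S = Suc n"
  shows "(\<Sum>p | p permutes S. marked_weight f c p S a) = fact n * (\<Sum>m\<le>n. f (Suc m) * z (n - m))"
  using S
proof (induction n arbitrary: S a f)
  case 0
  then have S: "S = {a}"
    by (metis One_nat_def card_1_singletonE singletonD)
  have "Orbits.orbit (\<lambda>x. x) a = {a}"
    by (simp add: orbit_eq_singleton_iff)
  then show ?case
    unfolding S by (simp add: marked_weight_def perm_cycles_def z0)
next
  case (Suc n)
  define T where "T = S - {a}"
  have T: "S = insert a T" "a \<notin> T" "finite T" "card T = Suc n"
    using Suc.prems by (auto simp: T_def)
  from T(4) obtain a' where a': "a' \<in> T"
    by fastforce
  have "(\<Sum>p | p permutes S. marked_weight f c p S a) =
      (\<Sum>b\<in>insert a T. \<Sum>p | p permutes T. marked_weight f c (Transposition.transpose a b \<circ> p) (insert a T) a)"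
    unfolding T(1) by (rule sum_over_permutations_insert[OF T(3,2)])
  also have "\<dots> = (\<Sum>p | p permutes T. marked_weight f c p (insert a T) a) +
      (\<Sum>b\<in>T. \<Sum>p | p permutes T. marked_weight f c (Transposition.transpose a b \<circ> p) (insert a T) a)"
    using T by (subst sum.insert) auto
  \<comment> \<open>Here \<open>b = a\<close>: the marked point is fixed, and the induction hypothesis is used with \<open>f = c\<close> and any mark.\<close>
  also have "(\<Sum>p | p permutes T. marked_weight f c p (insert a T) a) =
      f 1 * (\<Sum>p | p permutes T. marked_weight c c p T a')"
    unfolding sum_distrib_left
    by (intro sum.cong refl)
       (use T a' in \<open>simp add: marked_weight_insert_fixed cycle_weight_marked\<close>)
  also have "\<dots> = f 1 * (fact n * (of_nat (Suc n) * z (Suc n)))"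
    unfolding z_Suc by (subst Suc.IH[OF T(3) a' T(4)]) simp
  also have "(\<Sum>b\<in>T. \<Sum>p | p permutes T. marked_weight f c (Transposition.transpose a b \<circ> p) (insert a T) a) =
      (\<Sum>b\<in>T. \<Sum>p | p permutes T. marked_weight (\<lambda>m. f (Suc m)) c p T b)"
    by (intro sum.cong refl marked_weight_insert_point) (use T in auto)
  also have "\<dots> = (\<Sum>b\<in>T. fact n * (\<Sum>m\<le>n. f (Suc (Suc m)) * z (n - m)))"
    by (intro sum.cong refl Suc.IH) (use T in auto)
  also have "\<dots> = fact (Suc n) * (\<Sum>m\<le>n. f (Suc (Suc m)) * z (n - m))"
    using T(4) by (simp add: algebra_simps)
  also have "f 1 * (fact n * (of_nat (Suc n) * z (Suc n))) = fact (Suc n) * (f 1 * z (Suc n))"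
    by (simp add: algebra_simps)
  finally show ?case
    unfolding sum.atMost_Suc_shift by (simp add: distrib_left)
qed

lemma sum_cycle_weight:
  fixes c z :: "nat \<Rightarrow> 'b::{comm_ring_1, ring_char_0}"
  assumes z0: "z 0 = 1"
    and z_Suc: "\<And>n. of_nat (Suc n) * z (Suc n) = (\<Sum>m\<le>n. c (Suc m) * z (n - m))"
    and S: "finite S"
  shows "(\<Sum>p | p permutes S. cycle_weight c p S) = fact (card S) * z (card S)"
proof (cases "card S")
  case 0
  then have "S = {}" using S by simp
  then show ?thesis by (simp add: cycle_weight_def perm_cycles_def z0)
next
  case (Suc n)
  then obtain a where a: "a \<in> S" by fastforce
  have "(\<Sum>p | p permutes S. cycle_weight c p S) = (\<Sum>p | p permutes S. marked_weight c c p S a)"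
    using S a by (simp add: cycle_weight_marked)
  also have "\<dots> = fact n * (of_nat (Suc n) * z (Suc n))"
    unfolding z_Suc by (rule sum_marked_weight[OF z0 z_Suc S a Suc])
  finally show ?thesis
    using Suc by (simp add: algebra_simps)
qed

text \<open>
  A cycle of length \<open>m\<close> has sign \<open>(- 1) ^ (m + 1)\<close>: inserting a point into a cycle multiplies the
  permutation by a transposition and lengthens that cycle by one.
\<close>

lemma sign_eq_cycle_weight:
  assumes "finite S" "p permutes S"
  shows "of_int (sign p) = cycle_weight (\<lambda>m. (- 1) ^ Suc m :: 'b::comm_ring_1) p S"
  using assms
proof (induction S arbitrary: p rule: finite_induct)
  case empty
  then show ?case by (simp add: cycle_weight_def perm_cycles_def)
next
  case (insert x S)
  from insert.prems have "p \<in> {p. p permutes insert x S}"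
    by simp
  then obtain b q
    where p: "p = Transposition.transpose x b \<circ> q" "b \<in> insert x S" "q permutes S"
    unfolding permutes_insert by auto
  let ?w = "\<lambda>m. (- 1) ^ Suc m :: 'b"
  have IH: "of_int (sign q) = cycle_weight ?w q S"
    using insert.IH p(3) .
  have "cycle_weight ?w p (insert x S) = marked_weight ?w ?w p (insert x S) x"
    using insert.hyps by (simp add: cycle_weight_marked)
  also have "\<dots> = of_int (sign p)"
  proof (cases "b = x")
    case True
    then have "p = q" using p by simp
    then show ?thesis
      using marked_weight_insert_fixed[OF p(3) insert.hyps(2), of ?w ?w] IH by simp
  next
    case False
    then have b: "b \<in> S" using p by simp
    have "marked_weight ?w ?w p (insert x S) x = marked_weight (\<lambda>m. ?w (Suc m)) ?w q S b"
      unfolding p(1) by (rule marked_weight_insert_point[OF p(3) insert.hyps b])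
    also have "\<dots> = - marked_weight ?w ?w q S b"
      by (simp add: marked_weight_def)
    also have "\<dots> = - cycle_weight ?w q S"
      using cycle_weight_marked[OF insert.hyps(1) b, of ?w q] by simp
    also have "\<dots> = - of_int (sign q)"
      by (simp only: IH)
    also have "\<dots> = of_int (sign p)"
    proof -
      have "permutation q"
        using p(3) insert.hyps(1) permutation_permutes by blast
      then have "sign p = - sign q"
        using False unfolding p(1) by (simp add: sign_compose permutation_swap_id sign_swap_id)
      then show ?thesis by simp
    qed
    finally show ?thesis .
  qed
  finally show ?case ..
qed

text \<open>
  The sorted list of cycle lengths is only a numbering of the cycles.
\<close>

lemma cycle_type_prod:
  assumes p: "p permutes {1..n}"
  shows "(\<Prod>m<length (cycle_type n p). c (cycle_type n p ! m)) = cycle_weight c p {1..n}"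
proof -
  let ?l = "cycle_type n p"
  have "(\<Prod>m<length ?l. c (?l ! m)) = prod_list (map c ?l)"
    by (subst prod.list_conv_set_nth) (simp add: lessThan_atLeast0)
  also have "\<dots> = prod_mset (image_mset c (mset ?l))"
    by (metis mset_map prod_mset_prod_list)
  also have "mset ?l = image_mset card (mset_set (perm_cycles p {1..n}))"
    by (simp add: cycle_type_def perm_cycles_def)
  finally show ?thesis
    by (simp add: cycle_weight_def prod_unfold_prod_mset image_mset.compositionality comp_def)
qed

lemma cycle_type_bounds:
  assumes p: "p permutes {1..n}"
  shows "length (cycle_type n p) \<le> n"
    and "m < length (cycle_type n p) \<Longrightarrow> cycle_type n p ! m \<le> n"
proof -
  have m: "mset (cycle_type n p) = image_mset card (mset_set (perm_cycles p {1..n}))"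
    by (simp add: cycle_type_def perm_cycles_def)
  have "length (cycle_type n p) = card (perm_cycles p {1..n})"
    by (metis m size_image_mset size_mset size_mset_set)
  also have "\<dots> \<le> n"
    using card_image_le[of "{1..n}" "Orbits.orbit p"] by (simp add: perm_cycles_def)
  finally show "length (cycle_type n p) \<le> n" .
  assume "m < length (cycle_type n p)"
  then have "cycle_type n p ! m \<in># mset (cycle_type n p)"
    by simp
  then obtain C where "C \<in> perm_cycles p {1..n}" "cycle_type n p ! m = card C"
    unfolding m using finite_perm_cycles[of "{1..n}" p] by auto
  then show "cycle_type n p ! m \<le> n"
    using perm_cycles_subset[OF p] card_mono[of "{1..n}"] by fastforce
qed

section \<open>Taylor coefficients of products of complex powers\<close>

text \<open>
  The recursion comes from comparing coefficients in \<open>f' = f * g\<close>, where \<open>f\<close> is the product and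
  \<open>g t = (\<Sum>k\<in>K. \<beta> k * y k / (1 - y k * t))\<close> expands into geometric series. The \<open>y k\<close> are
  arbitrary; only a neighbourhood of \<open>0\<close> matters.
\<close>

lemma powr_prod_coeff_recursion:
  fixes \<beta> y :: "'k \<Rightarrow> complex"
  assumes K: "finite K"
  defines "F \<equiv> fps_expansion (\<lambda>t. \<Prod>k\<in>K. (1 - y k * t) powr (- \<beta> k)) 0"
  shows "fps_nth F 0 = 1"
    and "of_nat (Suc n) * fps_nth F (Suc n) =
      (\<Sum>m\<le>n. (\<Sum>k\<in>K. \<beta> k * y k ^ Suc m) * fps_nth F (n - m))"
proof -
  define f where "f t = (\<Prod>k\<in>K. (1 - y k * t) powr (- \<beta> k))" for t
  define g where "g t = (\<Sum>k\<in>K. \<beta> k * y k * inverse (1 - y k * t))" for t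
  define G where "G = (\<Sum>k\<in>K. fps_const (\<beta> k * y k) * Abs_fps (\<lambda>n. y k ^ n))"
  define A where "A = (\<Inter>k\<in>K. {t. norm (y k * t) < 1})"
  have A: "open A" "0 \<in> A"
    using K by (auto simp: A_def intro!: open_INT open_Collect_less continuous_intros)
  have nonpos: "1 - y k * t \<notin> \<real>\<^sub>\<le>\<^sub>0" if "t \<in> A" "k \<in> K" for t k
  proof -
    have "Re (y k * t) < 1"
      using that complex_Re_le_cmod[of "y k * t"] by (auto simp: A_def)
    then show ?thesis by (auto simp: complex_nonpos_Reals_iff)
  qed
  have f_exp: "f t = exp (\<Sum>k\<in>K. - \<beta> k * Ln (1 - y k * t))" if "t \<in> A" for t
    unfolding f_def exp_sum[OF K]
    using nonpos[OF that] by (intro prod.cong refl) (force simp: powr_def)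
  have f_deriv: "(f has_field_derivative f t * g t) (at t)" if t: "t \<in> A" for t
  proof -
    have "((\<lambda>t. exp (\<Sum>k\<in>K. - \<beta> k * Ln (1 - y k * t))) has_field_derivative
        exp (\<Sum>k\<in>K. - \<beta> k * Ln (1 - y k * t)) * g t) (at t)"
      unfolding g_def
      by (rule derivative_eq_intros refl nonpos t | assumption | simp add: field_simps sum_negf)+
    then have "((\<lambda>t. exp (\<Sum>k\<in>K. - \<beta> k * Ln (1 - y k * t))) has_field_derivative f t * g t) (at t)"
      using f_exp[OF t] by simp
    then show ?thesis
      by (rule has_field_derivative_transform_within_open[OF _ A(1) t]) (simp add: f_exp)
  qed
  have F: "f has_fps_expansion F"
    unfolding F_def f_def[symmetric]
    using A f_deriv by (intro has_fps_expansion_fps_expansion[of A]) (auto simp: holomorphic_on_open)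
  have "(\<lambda>t. inverse (1 - y k * t)) has_fps_expansion Abs_fps (\<lambda>n. y k ^ n)" for k
  proof -
    have "(\<lambda>t. inverse (1 - y k * t)) has_fps_expansion inverse (1 - fps_const (y k) * fps_X)"
      by (intro fps_expansion_intros) simp
    also have "inverse (1 - fps_const (y k) * fps_X) = Abs_fps (\<lambda>n. y k ^ n)"
      using one_minus_const_fps_X_neg_power'[of 1 "y k"] by simp
    finally show ?thesis .
  qed
  then have G: "g has_fps_expansion G"
    unfolding g_def G_def by (intro fps_expansion_intros)
  have "deriv f has_fps_expansion F * G"
  proof (rule has_fps_expansion_cong[THEN iffD1, OF _ refl])
    show "(\<lambda>t. f t * g t) has_fps_expansion F * G"
      using F G by (intro fps_expansion_intros)
    have "f t * g t = deriv f t" if "t \<in> A" for t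
      by (rule DERIV_imp_deriv[OF f_deriv[OF that], symmetric])
    then show "\<forall>\<^sub>F t in nhds 0. f t * g t = deriv f t"
      by (rule eventually_nhds_in_open[OF A, THEN eventually_mono])
  qed
  then have eq: "fps_deriv F = G * F"
    using has_fps_expansion_deriv[OF F] fps_expansion_unique_complex by (metis mult.commute)
  have "fps_nth F 0 = f 0"
    using has_fps_expansion_imp_0_eq_fps_nth_0[OF F] by simp
  then show "fps_nth F 0 = 1"
    by (simp add: f_def)
  have "of_nat (Suc n) * fps_nth F (Suc n) = fps_nth (fps_deriv F) n"
    by simp
  also have "\<dots> = (\<Sum>m\<le>n. fps_nth G m * fps_nth F (n - m))"
    unfolding eq fps_mult_nth atLeast0AtMost ..
  also have "\<dots> = (\<Sum>m\<le>n. (\<Sum>k\<in>K. \<beta> k * y k ^ Suc m) * fps_nth F (n - m))"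
    by (simp add: G_def fps_sum_nth mult.assoc)
  finally show "of_nat (Suc n) * fps_nth F (Suc n) =
      (\<Sum>m\<le>n. (\<Sum>k\<in>K. \<beta> k * y k ^ Suc m) * fps_nth F (n - m))" .
qed

section \<open>Averages over the alternating group\<close>

lemma sum_powr_prod_cycle_weight:
  fixes \<beta> y :: "'k \<Rightarrow> complex"
  assumes "finite K"
  shows "(\<Sum>p | p permutes {1..n::nat}. cycle_weight (\<lambda>m. \<Sum>k\<in>K. \<beta> k * y k ^ m) p {1..n}) =
    fact n * fps_nth (fps_expansion (\<lambda>t. \<Prod>k\<in>K. (1 - y k * t) powr (- \<beta> k)) 0) n"
  by (subst sum_cycle_weight[where z = "fps_nth
        (fps_expansion (\<lambda>t. \<Prod>k\<in>K. (1 - y k * t) powr (- \<beta> k)) 0)"])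
     (use powr_prod_coeff_recursion[OF assms, where y = y and \<beta> = \<beta>] in auto)

text \<open>
  Multiplying \<open>c m = (\<Sum>k\<in>K. \<beta> k * y k ^ m)\<close> by the sign \<open>(- 1) ^ Suc m\<close> of an \<open>m\<close>-cycle replaces
  \<open>\<beta>\<close> and \<open>y\<close> by their negatives, which turns the factors \<open>(1 - y k * t) powr (- \<beta> k)\<close> into
  \<open>(1 + y k * t) powr \<beta> k\<close>.
\<close>

lemma alt_group_average_cycle_weight:
  fixes \<beta> y :: "'k \<Rightarrow> complex"
  assumes K: "finite K" and n: "n \<ge> 2"
  shows "(\<Sum>p\<in>carrier (alt_group n). cycle_weight (\<lambda>m. \<Sum>k\<in>K. \<beta> k * y k ^ m) p {1..n}) /
      of_nat (card (carrier (alt_group n))) =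
    fps_nth (fps_expansion (\<lambda>t. \<Prod>k\<in>K. (1 - y k * t) powr (- \<beta> k)) 0) n +
    fps_nth (fps_expansion (\<lambda>t. \<Prod>k\<in>K. (1 + y k * t) powr \<beta> k) 0) n"
    (is "(\<Sum>p\<in>?A. cycle_weight ?c p _) / _ = ?z + ?z'")
proof -
  let ?S = "{p. p permutes {1..n}}"
  have fin: "finite ?S"
    by (rule finite_permutations) simp
  have signed: "of_int (sign p) * cycle_weight ?c p {1..n} =
      cycle_weight (\<lambda>m. \<Sum>k\<in>K. (- \<beta> k) * (- y k) ^ m) p {1..n}" if "p \<in> ?S" for p
  proof -
    have "of_int (sign p) * cycle_weight ?c p {1..n} =
        cycle_weight (\<lambda>m. (- 1) ^ Suc m) p {1..n} * cycle_weight ?c p {1..n}"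
      using that by (subst sign_eq_cycle_weight[of "{1..n}"]) auto
    also have "\<dots> = cycle_weight (\<lambda>m. (- 1) ^ Suc m * ?c m) p {1..n}"
      by (simp only: cycle_weight_def prod.distrib)
    also have "(\<lambda>m. (- 1) ^ Suc m * ?c m) = (\<lambda>m. \<Sum>k\<in>K. (- \<beta> k) * (- y k) ^ m)"
      by (auto simp: fun_eq_iff sum_distrib_left power_minus[of "y _"] sum_negf[symmetric]
          intro!: sum.cong)
    finally show ?thesis .
  qed
  have "2 * (\<Sum>p\<in>?A. cycle_weight ?c p {1..n}) =
      (\<Sum>p\<in>?A. (1 + of_int (sign p)) * cycle_weight ?c p {1..n})"
    unfolding sum_distrib_left by (intro sum.cong) (auto simp: alt_group_carrier sign_def)
  also have "\<dots> = (\<Sum>p\<in>?S. (1 + of_int (sign p)) * cycle_weight ?c p {1..n})"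
    by (rule sum.mono_neutral_left[OF fin]) (auto simp: alt_group_carrier sign_def)
  also have "\<dots> = (\<Sum>p\<in>?S. cycle_weight ?c p {1..n}) +
      (\<Sum>p\<in>?S. cycle_weight (\<lambda>m. \<Sum>k\<in>K. (- \<beta> k) * (- y k) ^ m) p {1..n})"
    by (simp only: distrib_right mult_1 sum.distrib signed cong: sum.cong)
  also have "\<dots> = fact n * (?z + ?z')"
    unfolding sum_powr_prod_cycle_weight[OF K] by (simp add: distrib_left)
  finally have sum: "2 * (\<Sum>p\<in>?A. cycle_weight ?c p {1..n}) = fact n * (?z + ?z')" .
  have card: "2 * complex_of_nat (card ?A) = fact n"
    using arg_cong[OF alt_group_card_carrier[OF n], of complex_of_nat] by simp
  then have "card ?A \<noteq> 0"
    by (metis fact_nonzero mult_zero_right of_nat_0)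
  moreover have "(\<Sum>p\<in>?A. cycle_weight ?c p {1..n}) = of_nat (card ?A) * (?z + ?z')"
    using sum unfolding card[symmetric] mult.assoc by (simp only: mult_cancel_left) simp
  ultimately show ?thesis
    by simp
qed

section \<open>Expectations of the randomized class functions\<close>

text \<open>
  The monomial with exponents \<open>k = (k1, k2)\<close>, as a function of a pair.
\<close>

definition monom2 :: "nat \<times> nat \<Rightarrow> complex \<times> complex \<Rightarrow> complex" where
  "monom2 k z = fst z ^ fst k * snd z ^ snd k"

lemma measurable_monom2 [measurable]: "monom2 k \<in> borel_measurable borel"
  unfolding monom2_def[abs_def]
  by (intro borel_measurable_continuous_onI continuous_intros)

text \<open>
  Each factor \<open>Y m\<close> is a combination of products of monomials over a block \<open>J m\<close> of the iid family.
  Blocks are disjoint, so the factors are independent; inside a block the monomials are independent,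
  so each contributes its moment to the power of the size of the block.
\<close>

lemma (in prob_space) expectation_blocks:
  fixes X :: "'i \<Rightarrow> 'a \<Rightarrow> complex \<times> complex" and a :: "'m \<Rightarrow> nat \<times> nat \<Rightarrow> complex"
    and K :: "(nat \<times> nat) set"
  assumes indep: "indep_vars (\<lambda>_. borel) X I"
    and distr: "\<And>i. i \<in> I \<Longrightarrow> distr M borel (X i) = D"
    and integrable: "\<And>k. integrable D (monom2 k)"
    and L: "finite L" and J: "\<And>m. m \<in> L \<Longrightarrow> J m \<subseteq> I" "\<And>m. m \<in> L \<Longrightarrow> finite (J m)"
    and disj: "disjoint_family_on J L"
  defines "Y \<equiv> \<lambda>m \<omega>. \<Sum>k\<in>K. a m k * (\<Prod>i\<in>J m. monom2 k (X i \<omega>))"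
  shows "expectation (\<lambda>\<omega>. \<Prod>m\<in>L. Y m \<omega>) =
      (\<Prod>m\<in>L. \<Sum>k\<in>K. a m k * (\<integral>z. monom2 k z \<partial>D) ^ card (J m))"
    and "Bochner_Integration.integrable M (\<lambda>\<omega>. \<Prod>m\<in>L. Y m \<omega>)"
proof -
  have X_meas: "random_variable borel (X i)" if "i \<in> I" for i
    using indep that by (simp add: indep_vars_def)
  have mon_int: "Bochner_Integration.integrable M (\<lambda>\<omega>. monom2 k (X i \<omega>))"
    and mon_exp: "expectation (\<lambda>\<omega>. monom2 k (X i \<omega>)) = (\<integral>z. monom2 k z \<partial>D)"
    if "i \<in> I" for i k
    using integrable[of k] X_meas[OF that]
    by (simp_all add: distr[OF that, symmetric] integrable_distr_eq integral_distr)
  have block_indep: "indep_vars (\<lambda>_. borel) (\<lambda>i \<omega>. monom2 k (X i \<omega>)) (J m)" if "m \<in> L" for m k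
    using indep_vars_compose2[OF indep_vars_subset[OF indep J(1)[OF that]], of "\<lambda>_. monom2 k" "\<lambda>_. borel"]
    by simp
  have block_int: "Bochner_Integration.integrable M (\<lambda>\<omega>. \<Prod>i\<in>J m. monom2 k (X i \<omega>))"
    and block_exp: "expectation (\<lambda>\<omega>. \<Prod>i\<in>J m. monom2 k (X i \<omega>)) =
      (\<integral>z. monom2 k z \<partial>D) ^ card (J m)" if m: "m \<in> L" for m k
  proof -
    have J': "i \<in> I" if "i \<in> J m" for i
      using J(1)[OF m] that by blast
    show "Bochner_Integration.integrable M (\<lambda>\<omega>. \<Prod>i\<in>J m. monom2 k (X i \<omega>))"
      by (rule indep_vars_integrable[OF J(2)[OF m] block_indep[OF m]]) (rule mon_int[OF J'])
    have "expectation (\<lambda>\<omega>. \<Prod>i\<in>J m. monom2 k (X i \<omega>)) =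
        (\<Prod>i\<in>J m. expectation (\<lambda>\<omega>. monom2 k (X i \<omega>)))"
      by (rule indep_vars_lebesgue_integral[OF J(2)[OF m] block_indep[OF m]]) (rule mon_int[OF J'])
    then show "expectation (\<lambda>\<omega>. \<Prod>i\<in>J m. monom2 k (X i \<omega>)) = (\<integral>z. monom2 k z \<partial>D) ^ card (J m)"
      using mon_exp[OF J'] by simp
  qed
  have Y_int: "Bochner_Integration.integrable M (Y m)"
    and Y_exp: "expectation (Y m) = (\<Sum>k\<in>K. a m k * (\<integral>z. monom2 k z \<partial>D) ^ card (J m))"
    if "m \<in> L" for m
    using block_int[OF that] block_exp[OF that] by (simp_all add: Y_def[abs_def])
  define Z where "Z m x = (\<Sum>k\<in>K. a m k * (\<Prod>i\<in>J m. monom2 k (x i)))" for m x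
  have Z: "Z m \<in> borel_measurable (PiM (J m) (\<lambda>_. borel))" for m
    unfolding Z_def[abs_def] by measurable
  have "indep_vars (\<lambda>_. borel) (\<lambda>m \<omega>. Z m (restrict (\<lambda>i. X i \<omega>) (J m))) L"
    by (rule indep_vars_compose2[OF indep_vars_restrict[OF indep J(1) disj]]) (use Z in auto)
  then have Y_indep: "indep_vars (\<lambda>_. borel) Y L"
    by (simp add: Y_def Z_def)
  show "expectation (\<lambda>\<omega>. \<Prod>m\<in>L. Y m \<omega>) =
      (\<Prod>m\<in>L. \<Sum>k\<in>K. a m k * (\<integral>z. monom2 k z \<partial>D) ^ card (J m))"
    by (subst indep_vars_lebesgue_integral[OF L Y_indep Y_int]) (simp_all add: Y_exp)
  show "Bochner_Integration.integrable M (\<lambda>\<omega>. \<Prod>m\<in>L. Y m \<omega>)"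
    by (rule indep_vars_integrable[OF L Y_indep Y_int])
qed

text \<open>
  Conditioning on a uniformly distributed \<open>g\<close> that is independent of \<open>X\<close>. Independence is stated for
  the generated sigma-algebras, since \<open>g\<close> and \<open>X\<close> have different types.
\<close>

lemma (in prob_space) expectation_indep_uniform:
  fixes F :: "'g \<Rightarrow> 'x \<Rightarrow> complex"
  assumes A: "finite A"
    and g: "g \<in> measurable M (count_space A)"
    and g_unif: "distr M (count_space A) g = uniform_count_measure A"
    and X: "X \<in> measurable M N"
    and indep: "indep_set (sets (vimage_algebra (space M) g (count_space A)))
      (sets (vimage_algebra (space M) X N))"
    and F: "\<And>x. x \<in> A \<Longrightarrow> F x \<in> borel_measurable N"
    and F_int: "\<And>x. x \<in> A \<Longrightarrow> integrable M (\<lambda>\<omega>. F x (X \<omega>))"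
  shows "expectation (\<lambda>\<omega>. F (g \<omega>) (X \<omega>)) = (\<Sum>x\<in>A. expectation (\<lambda>\<omega>. F x (X \<omega>))) / of_nat (card A)"
proof -
  define E where "E x = g -` {x} \<inter> space M" for x
  have E: "E x \<in> events" if "x \<in> A" for x
    unfolding E_def by (rule measurable_sets[OF g]) (use that in simp)
  have g_in: "g \<omega> \<in> A" if "\<omega> \<in> space M" for \<omega>
    using measurable_space[OF g that] by simp
  have prob_E: "prob (E x) = 1 / real (card A)" if "x \<in> A" for x
  proof -
    have "prob (E x) = measure (distr M (count_space A) g) {x}"
      unfolding E_def by (subst measure_distr[OF g]) (use that in auto)
    also have "\<dots> = 1 / real (card A)"
      unfolding g_unif by (subst measure_uniform_count_measure) (use that A in auto)
    finally show ?thesis .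
  qed
  have split: "expectation (\<lambda>\<omega>. indicator (E x) \<omega> * F x (X \<omega>)) =
      complex_of_real (prob (E x)) * expectation (\<lambda>\<omega>. F x (X \<omega>))"
    and split_int: "integrable M (\<lambda>\<omega>. indicator (E x) \<omega> * F x (X \<omega>))" if x: "x \<in> A" for x
  proof -
    let ?i = "\<lambda>\<omega>. indicator (E x) \<omega> :: complex"
    have i_rv: "?i \<in> borel_measurable M"
      using E[OF x] by simp
    have "indep_var borel ?i borel (\<lambda>\<omega>. F x (X \<omega>))"
      unfolding indep_var_eq
    proof (intro conjI)
      show "?i \<in> borel_measurable M" by (rule i_rv)
      show "(\<lambda>\<omega>. F x (X \<omega>)) \<in> borel_measurable M"
        by (rule measurable_compose[OF X F[OF x]])
      let ?G = "vimage_algebra (space M) g (count_space A)" and ?H = "vimage_algebra (space M) X N"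
      have "E x \<in> sets ?G"
        unfolding E_def by (rule in_vimage_algebra) (use x in simp)
      then have "?i \<in> borel_measurable ?G"
        by simp
      then have 1: "sigma_sets (space M) {?i -` B \<inter> space M |B. B \<in> sets borel} \<subseteq> sets ?G"
        using measurable_sets[of ?i ?G borel]
        by (intro sets.sigma_sets_subset[of _ ?G, simplified]) auto
      have "X \<in> measurable ?H N"
        by (rule measurable_vimage_algebra1) (use measurable_space[OF X] in auto)
      then have "(\<lambda>\<omega>. F x (X \<omega>)) \<in> borel_measurable ?H"
        by (rule measurable_compose) (rule F[OF x])
      then have 2: "sigma_sets (space M) {(\<lambda>\<omega>. F x (X \<omega>)) -` B \<inter> space M |B. B \<in> sets borel} \<subseteq> sets ?H"
        using measurable_sets[of "\<lambda>\<omega>. F x (X \<omega>)" ?H borel]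
        by (intro sets.sigma_sets_subset[of _ ?H, simplified]) auto
      show "indep_set (sigma_sets (space M) {?i -` B \<inter> space M |B. B \<in> sets borel})
          (sigma_sets (space M) {(\<lambda>\<omega>. F x (X \<omega>)) -` B \<inter> space M |B. B \<in> sets borel})"
        using indep 1 2 unfolding indep_sets2_eq by blast
    qed
    moreover have "integrable M ?i"
      by (rule integrable_const_bound[where B = 1]) (use i_rv in \<open>auto simp: indicator_def\<close>)
    moreover have "expectation ?i = complex_of_real (prob (E x))"
    proof -
      have "expectation ?i = expectation (\<lambda>\<omega>. complex_of_real (indicator (E x) \<omega>))"
        by (intro Bochner_Integration.integral_cong) (auto simp: indicator_def)
      also have "\<dots> = complex_of_real (prob (E x))"
        using E[OF x] by (subst integral_complex_of_real) simp
      finally show ?thesis .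
    qed
    ultimately show "expectation (\<lambda>\<omega>. ?i \<omega> * F x (X \<omega>)) =
        complex_of_real (prob (E x)) * expectation (\<lambda>\<omega>. F x (X \<omega>))"
      "integrable M (\<lambda>\<omega>. ?i \<omega> * F x (X \<omega>))"
      using F_int[OF x] by (simp_all add: indep_var_lebesgue_integral indep_var_integrable)
  qed
  have "expectation (\<lambda>\<omega>. F (g \<omega>) (X \<omega>)) = expectation (\<lambda>\<omega>. \<Sum>x\<in>A. indicator (E x) \<omega> * F x (X \<omega>))"
  proof (rule Bochner_Integration.integral_cong[OF refl])
    fix \<omega> assume \<omega>: "\<omega> \<in> space M"
    have "(\<Sum>x\<in>A. indicator (E x) \<omega> * F x (X \<omega>)) = (\<Sum>x\<in>A. if x = g \<omega> then F x (X \<omega>) else 0)"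
      using \<omega> by (intro sum.cong) (auto simp: E_def)
    then show "F (g \<omega>) (X \<omega>) = (\<Sum>x\<in>A. indicator (E x) \<omega> * F x (X \<omega>))"
      using A g_in[OF \<omega>] by simp
  qed
  also have "\<dots> = (\<Sum>x\<in>A. complex_of_real (prob (E x)) * expectation (\<lambda>\<omega>. F x (X \<omega>)))"
    by (subst Bochner_Integration.integral_sum) (auto simp: split split_int)
  also have "\<dots> = (\<Sum>x\<in>A. expectation (\<lambda>\<omega>. F x (X \<omega>))) / of_nat (card A)"
    by (simp add: prob_E sum_divide_distrib)
  finally show ?thesis .
qed

text \<open>
  The common form of the two randomizations. The factor of the cycle numbered \<open>m\<close>, of length \<open>l\<close>,
  uses the block \<open>J m l\<close> of auxiliary variables: the single index \<open>m\<close> for \<open>W1\<close>, and the \<open>l\<close> indices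
  \<open>(m, i)\<close> with \<open>i < l\<close> for \<open>W2\<close>.
\<close>

lemma expectation_randomized_class_function:
  fixes th vth :: "'i \<Rightarrow> 'w \<Rightarrow> complex" and a :: "nat \<times> nat \<Rightarrow> nat \<Rightarrow> complex"
    and J :: "nat \<Rightarrow> nat \<Rightarrow> 'i set" and K :: "(nat \<times> nat) set"
  assumes rand: "randomization N n g I D th vth"
    and int: "\<And>k. integrable D (monom2 k)"
    and J: "\<And>m l. m < n \<Longrightarrow> l \<le> n \<Longrightarrow> J m l \<subseteq> I"
      "\<And>m l. finite (J m l)" "\<And>m l m' l'. m \<noteq> m' \<Longrightarrow> J m l \<inter> J m' l' = {}"
    and c: "\<And>m l. (\<Sum>k\<in>K. a k l * (\<integral>z. monom2 k z \<partial>D) ^ card (J m l)) = c l"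
    and W: "\<And>\<omega> p. p permutes {1..n} \<Longrightarrow> W \<omega> p = (\<Prod>m<length (cycle_type n p).
      \<Sum>k\<in>K. a k (cycle_type n p ! m) *
        (\<Prod>i\<in>J m (cycle_type n p ! m). monom2 k (th i \<omega>, vth i \<omega>)))"
  shows "(\<integral>\<omega>. W \<omega> (g \<omega>) \<partial>N) = (\<Sum>p\<in>carrier (alt_group n). cycle_weight c p {1..n}) /
    of_nat (card (carrier (alt_group n)))"
proof -
  let ?A = "carrier (alt_group n)"
  interpret prob_space N
    using rand by (simp add: randomization_def)
  define X where "X i \<omega> = (th i \<omega>, vth i \<omega>)" for i \<omega>
  have g: "g \<in> measurable N (count_space ?A)"
    and g_unif: "distr N (count_space ?A) g = uniform_count_measure ?A"
    and X_indep: "indep_vars (\<lambda>_. borel) X I"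
    and X_distr: "\<And>i. i \<in> I \<Longrightarrow> distr N borel (X i) = D"
    and gX_indep: "indep_set (sets (vimage_algebra (space N) g (count_space ?A)))
       (sets (vimage_algebra (space N) (\<lambda>\<omega>. \<lambda>i\<in>I. X i \<omega>) (PiM I (\<lambda>_. borel))))"
    using rand unfolding randomization_def X_def[abs_def] by auto
  have fin: "finite ?A"
    by (rule finite_subset[OF _ finite_permutations[of "{1..n}"]]) (auto simp: alt_group_carrier)
  define F where "F p x = (\<Prod>m<length (cycle_type n p). \<Sum>k\<in>K. a k (cycle_type n p ! m) *
      (\<Prod>i\<in>J m (cycle_type n p ! m). monom2 k (x i)))" for p and x :: "'i \<Rightarrow> complex \<times> complex"
  have J_sub: "J m (cycle_type n p ! m) \<subseteq> I" if "p \<in> ?A" "m < length (cycle_type n p)" for p m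
  proof (rule J(1))
    have "p permutes {1..n}" using that(1) by (simp add: alt_group_carrier)
    then show "m < n" "cycle_type n p ! m \<le> n"
      using cycle_type_bounds[of p n] that(2) by force+
  qed
  have F_X: "F p (\<lambda>i\<in>I. X i \<omega>) = F p (\<lambda>i. X i \<omega>)" if "p \<in> ?A" for p \<omega>
    unfolding F_def using J_sub[OF that]
    by (intro prod.cong sum.cong arg_cong2[where f = "(*)"] arg_cong[where f = "monom2 _"]) auto
  have F_meas: "F p \<in> borel_measurable (PiM I (\<lambda>_. borel))" if "p \<in> ?A" for p
  proof -
    have "(\<lambda>x. monom2 k (x i)) \<in> borel_measurable (PiM I (\<lambda>_. borel))"
      if "i \<in> I" for i :: 'i and k
      by (rule measurable_compose[OF measurable_component_singleton[OF that] measurable_monom2])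
    then show ?thesis
      unfolding F_def[abs_def] using J_sub[OF that]
      by (intro borel_measurable_prod borel_measurable_sum borel_measurable_times
          borel_measurable_const) blast
  qed
  have blocks: "expectation (\<lambda>\<omega>. F p (\<lambda>i. X i \<omega>)) = cycle_weight c p {1..n}"
    and blocks_int: "integrable N (\<lambda>\<omega>. F p (\<lambda>i. X i \<omega>))" if p: "p \<in> ?A" for p
  proof -
    let ?l = "cycle_type n p"
    have disj: "disjoint_family_on (\<lambda>m. J m (?l ! m)) {..<length ?l}"
      using J(3) by (auto simp: disjoint_family_on_def)
    note E = expectation_blocks[OF X_indep X_distr int finite_lessThan, of "length ?l"
        "\<lambda>m. J m (?l ! m)" "\<lambda>m k. a k (?l ! m)" K, OF _ J_sub[OF p] J(2) disj]
    have "expectation (\<lambda>\<omega>. F p (\<lambda>i. X i \<omega>)) = (\<Prod>m<length ?l. c (?l ! m))"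
      using E(1) by (simp add: F_def c)
    then show "expectation (\<lambda>\<omega>. F p (\<lambda>i. X i \<omega>)) = cycle_weight c p {1..n}"
      using p by (simp add: cycle_type_prod alt_group_carrier)
    show "integrable N (\<lambda>\<omega>. F p (\<lambda>i. X i \<omega>))"
      using E(2) by (simp add: F_def)
  qed
  have "expectation (\<lambda>\<omega>. W \<omega> (g \<omega>)) = expectation (\<lambda>\<omega>. F (g \<omega>) (\<lambda>i\<in>I. X i \<omega>))"
  proof (rule Bochner_Integration.integral_cong[OF refl])
    fix \<omega> assume "\<omega> \<in> space N"
    then have A: "g \<omega> \<in> ?A"
      using measurable_space[OF g] by simp
    show "W \<omega> (g \<omega>) = F (g \<omega>) (\<lambda>i\<in>I. X i \<omega>)"
      unfolding F_X[OF A] using A W by (simp add: F_def X_def alt_group_carrier)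
  qed
  also have "\<dots> = (\<Sum>p\<in>?A. expectation (\<lambda>\<omega>. F p (\<lambda>i\<in>I. X i \<omega>))) / of_nat (card ?A)"
  proof (rule expectation_indep_uniform[OF fin g g_unif _ gX_indep F_meas])
    show "(\<lambda>\<omega>. \<lambda>i\<in>I. X i \<omega>) \<in> measurable N (PiM I (\<lambda>_. borel))"
      using X_indep by (intro measurable_restrict) (simp add: indep_vars_def)
    show "integrable N (\<lambda>\<omega>. F p (\<lambda>i\<in>I. X i \<omega>))" if "p \<in> ?A" for p
      using blocks_int[OF that] by (simp add: F_X[OF that])
  qed
  also have "\<dots> = (\<Sum>p\<in>?A. cycle_weight c p {1..n}) / of_nat (card ?A)"
    by (simp add: F_X blocks cong: sum.cong)
  finally show ?thesis .
qed

section \<open>Holomorphy in three variables\<close>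

text \<open>
  Pointwise complex differentiability in three variables: the Frechet derivative is homogeneous
  over the complex numbers.
\<close>

definition complex_differentiable3 ::
    "(complex \<times> complex \<times> complex \<Rightarrow> complex) \<Rightarrow> complex \<times> complex \<times> complex \<Rightarrow> bool" where
  "complex_differentiable3 f z \<longleftrightarrow>
     (\<exists>D. (f has_derivative D) (at z) \<and>
        (\<forall>c h1 h2 h3. D (c * h1, c * h2, c * h3) = c * D (h1, h2, h3)))"

lemma complex_differentiable3I:
  assumes "(f has_derivative D) (at z)"
    and "\<And>c h1 h2 h3. D (c * h1, c * h2, c * h3) = c * D (h1, h2, h3)"
  shows "complex_differentiable3 f z"
  using assms unfolding complex_differentiable3_def by blast

lemma complex_differentiable3_const: "complex_differentiable3 (\<lambda>_. c) z"
  by (rule complex_differentiable3I[where D = "\<lambda>_. 0"]) auto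

lemma complex_differentiable3_coords:
  "complex_differentiable3 (\<lambda>w. fst w) z"
  "complex_differentiable3 (\<lambda>w. fst (snd w)) z"
  "complex_differentiable3 (\<lambda>w. snd (snd w)) z"
proof -
  show "complex_differentiable3 (\<lambda>w. fst w) z"
    by (rule complex_differentiable3I[where D = "\<lambda>w. fst w"])
       (auto intro!: has_derivative_fst has_derivative_ident)
  show "complex_differentiable3 (\<lambda>w. fst (snd w)) z"
    by (rule complex_differentiable3I[where D = "\<lambda>w. fst (snd w)"])
       (auto intro!: has_derivative_fst has_derivative_snd has_derivative_ident)
  show "complex_differentiable3 (\<lambda>w. snd (snd w)) z"
    by (rule complex_differentiable3I[where D = "\<lambda>w. snd (snd w)"])
       (auto intro!: has_derivative_snd has_derivative_ident)
qed

lemma complex_differentiable3_mult: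
  assumes "complex_differentiable3 f z" "complex_differentiable3 g z"
  shows "complex_differentiable3 (\<lambda>w. f w * g w) z"
proof -
  from assms obtain D E where
    "(f has_derivative D) (at z)" "\<And>c h1 h2 h3. D (c * h1, c * h2, c * h3) = c * D (h1, h2, h3)"
    "(g has_derivative E) (at z)" "\<And>c h1 h2 h3. E (c * h1, c * h2, c * h3) = c * E (h1, h2, h3)"
    unfolding complex_differentiable3_def by blast
  then show ?thesis
    by (intro complex_differentiable3I[OF has_derivative_mult]) (auto simp: algebra_simps)
qed

lemma complex_differentiable3_prod:
  assumes "\<And>k. k \<in> K \<Longrightarrow> complex_differentiable3 (f k) z"
  shows "complex_differentiable3 (\<lambda>w. \<Prod>k\<in>K. f k w) z"
  using assms
  by (induction K rule: infinite_finite_induct)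
     (auto intro: complex_differentiable3_const complex_differentiable3_mult)

lemma complex_differentiable3_power:
  assumes "complex_differentiable3 f z"
  shows "complex_differentiable3 (\<lambda>w. f w ^ m) z"
  using complex_differentiable3_prod[of "{..<m}" "\<lambda>_. f"] assms by simp

lemma complex_differentiable3_compose:
  assumes "complex_differentiable3 f z" and g: "(g has_field_derivative g') (at (f z))"
  shows "complex_differentiable3 (\<lambda>w. g (f w)) z"
proof -
  from assms obtain D where
    D: "(f has_derivative D) (at z)" "\<And>c h1 h2 h3. D (c * h1, c * h2, c * h3) = c * D (h1, h2, h3)"
    unfolding complex_differentiable3_def by blast
  have "((\<lambda>w. g (f w)) has_derivative (\<lambda>h. g' * D h)) (at z)"
    using has_derivative_compose[OF D(1), of g "(*) g'"] g by (simp add: has_field_derivative_def)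
  then show ?thesis
    by (rule complex_differentiable3I) (simp add: D(2))
qed

text \<open>
  The open neighbourhood is the set where all \<open>a k1 k2 * x1 ^ k1 * x2 ^ k2 * t\<close>, for \<open>(k1, k2) \<in> K\<close>,
  have modulus less than \<open>1\<close>; there the bases stay off the branch cut of the logarithm.
\<close>

lemma holomorphic3_on_powr_prod:
  fixes a e :: "nat \<Rightarrow> nat \<Rightarrow> complex"
  assumes K: "finite K" and a: "\<And>k1 k2. (k1, k2) \<in> K \<Longrightarrow> norm (a k1 k2) \<le> 1"
  shows "holomorphic3_on
    (\<lambda>(t, x1, x2). \<Prod>(k1, k2)\<in>K. (1 + a k1 k2 * x1 ^ k1 * x2 ^ k2 * t) powr e k1 k2)
    {(t, x1, x2). norm t < 1 \<and> max (norm x1) (norm x2) \<le> 1}"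
proof -
  define q where "q k w = a (fst k) (snd k) * fst (snd w) ^ fst k * snd (snd w) ^ snd k * fst w"
    for k :: "nat \<times> nat" and w :: "complex \<times> complex \<times> complex"
  define U where "U = (\<Inter>k\<in>K. {w. norm (q k w) < 1})"
  have fun_eq: "(\<lambda>(t, x1, x2). \<Prod>(k1, k2)\<in>K. (1 + a k1 k2 * x1 ^ k1 * x2 ^ k2 * t) powr e k1 k2)
      = (\<lambda>w. \<Prod>k\<in>K. (1 + q k w) powr e (fst k) (snd k))"
    by (auto simp: q_def split_beta)
  have "open U"
    unfolding U_def q_def using K by (auto intro!: open_INT open_Collect_less continuous_intros)
  moreover have "{(t, x1, x2). norm t < 1 \<and> max (norm x1) (norm x2) \<le> 1} \<subseteq> U"
  proof safe
    fix t x1 x2 :: complex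
    assume *: "norm t < 1" "max (norm x1) (norm x2) \<le> 1"
    have "norm (q k (t, x1, x2)) < 1" if "k \<in> K" for k
    proof -
      have "norm (a (fst k) (snd k)) * norm x1 ^ fst k * norm x2 ^ snd k \<le> 1"
        using a[of "fst k" "snd k"] that *
        by (intro mult_le_one power_le_one mult_nonneg_nonneg) auto
      then have "norm (a (fst k) (snd k)) * norm x1 ^ fst k * norm x2 ^ snd k * norm t \<le> norm t"
        by (intro mult_left_le_one_le) auto
      then show ?thesis
        using *(1) by (simp add: q_def norm_mult norm_power)
    qed
    then show "(t, x1, x2) \<in> U" by (simp add: U_def)
  qed
  moreover have "complex_differentiable3 (\<lambda>w. \<Prod>k\<in>K. (1 + q k w) powr e (fst k) (snd k)) z"
    if "z \<in> U" for z
  proof (rule complex_differentiable3_prod)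
    fix k assume k: "k \<in> K"
    have "\<bar>Re (q k z)\<bar> < 1"
      using that k abs_Re_le_cmod[of "q k z"] by (auto simp: U_def)
    then have "1 + q k z \<notin> \<real>\<^sub>\<le>\<^sub>0"
      by (auto simp: complex_nonpos_Reals_iff)
    then have "((\<lambda>u. (1 + u) powr e (fst k) (snd k)) has_field_derivative
        e (fst k) (snd k) * (1 + q k z) powr (e (fst k) (snd k) - 1)) (at (q k z))"
      by (auto intro!: derivative_eq_intros)
    moreover have "complex_differentiable3 (q k) z"
      unfolding q_def[abs_def]
      by (intro complex_differentiable3_mult complex_differentiable3_power
          complex_differentiable3_const complex_differentiable3_coords)
    ultimately show "complex_differentiable3 (\<lambda>w. (1 + q k w) powr e (fst k) (snd k)) z"
      by (rule complex_differentiable3_compose[rotated])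
  qed
  ultimately show ?thesis
    unfolding holomorphic3_on_def fun_eq complex_differentiable3_def by blast
qed

section \<open>The two generating functions\<close>

theorem theorem7p4:
  fixes M :: "'a measure" and N1 :: "'b measure" and N2 :: "'c measure"
    and th vth :: "'a \<Rightarrow> complex"
    and b \<alpha> :: "nat \<Rightarrow> nat \<Rightarrow> complex"
    and P :: "complex \<Rightarrow> complex \<Rightarrow> complex"
    and n :: nat
    and g1 :: "'b \<Rightarrow> nat \<Rightarrow> nat" and th1 vth1 :: "nat \<Rightarrow> 'b \<Rightarrow> complex"
    and g2 :: "'c \<Rightarrow> nat \<Rightarrow> nat" and th2 vth2 :: "nat \<times> nat \<Rightarrow> 'c \<Rightarrow> complex"
    and K :: "(nat \<times> nat) set"
  defines "P \<equiv> poly2 b"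
    and "K \<equiv> {(k1, k2). b k1 k2 \<noteq> 0}"
    and "\<alpha> \<equiv> \<lambda>k1 k2. \<integral>\<omega>. th \<omega> ^ k1 * vth \<omega> ^ k2 \<partial>M"
  assumes "prob_space M"
    and "th \<in> borel_measurable M" and "vth \<in> borel_measurable M"
    and "\<And>\<omega>. \<omega> \<in> space M \<Longrightarrow> th \<omega> \<in> sphere 0 1"
    and "\<And>\<omega>. \<omega> \<in> space M \<Longrightarrow> vth \<omega> \<in> sphere 0 1"
    and "finite K"
    and "n \<ge> 2"
    and "randomization N1 n g1 {..<n}
           (distr M borel (\<lambda>\<omega>. (th \<omega>, vth \<omega>))) th1 vth1"
    and "randomization N2 n g2 ({..<n} \<times> {..<n})
           (distr M borel (\<lambda>\<omega>. (th \<omega>, vth \<omega>))) th2 vth2"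
  shows
    "(\<forall>x1 x2. (\<integral>\<omega>. W1 P x1 x2 (\<lambda>m. th1 m \<omega>) (\<lambda>m. vth1 m \<omega>) n (g1 \<omega>) \<partial>N1) =
        fps_nth (fps_expansion
          (\<lambda>t. \<Prod>(k1, k2)\<in>K. (1 - x1 ^ k1 * x2 ^ k2 * t) powr (- (b k1 k2 * \<alpha> k1 k2))) 0) n
      + fps_nth (fps_expansion
          (\<lambda>t. \<Prod>(k1, k2)\<in>K. (1 + x1 ^ k1 * x2 ^ k2 * t) powr (b k1 k2 * \<alpha> k1 k2)) 0) n)
   \<and> (\<forall>x1 x2. (\<integral>\<omega>. W2 P x1 x2 (\<lambda>p. th2 p \<omega>) (\<lambda>p. vth2 p \<omega>) n (g2 \<omega>) \<partial>N2) =
        fps_nth (fps_expansion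
          (\<lambda>t. \<Prod>(k1, k2)\<in>K. (1 - \<alpha> k1 k2 * x1 ^ k1 * x2 ^ k2 * t) powr (- b k1 k2)) 0) n
      + fps_nth (fps_expansion
          (\<lambda>t. \<Prod>(k1, k2)\<in>K. (1 + \<alpha> k1 k2 * x1 ^ k1 * x2 ^ k2 * t) powr (b k1 k2)) 0) n)
   \<and> (let S = {(t, x1, x2). norm t < 1 \<and> max (norm x1) (norm x2) \<le> 1} in
        holomorphic3_on (\<lambda>(t, x1, x2).
          \<Prod>(k1, k2)\<in>K. (1 - x1 ^ k1 * x2 ^ k2 * t) powr (- (b k1 k2 * \<alpha> k1 k2))) S
      \<and> holomorphic3_on (\<lambda>(t, x1, x2).
          \<Prod>(k1, k2)\<in>K. (1 + x1 ^ k1 * x2 ^ k2 * t) powr (b k1 k2 * \<alpha> k1 k2)) S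
      \<and> holomorphic3_on (\<lambda>(t, x1, x2).
          \<Prod>(k1, k2)\<in>K. (1 - \<alpha> k1 k2 * x1 ^ k1 * x2 ^ k2 * t) powr (- b k1 k2)) S
      \<and> holomorphic3_on (\<lambda>(t, x1, x2).
          \<Prod>(k1, k2)\<in>K. (1 + \<alpha> k1 k2 * x1 ^ k1 * x2 ^ k2 * t) powr (b k1 k2)) S)"
proof -
  have K: "finite K" "{(k1, k2). b k1 k2 \<noteq> 0} = K"
    using assms(9) by (simp_all add: K_def)
  let ?D = "distr M borel (\<lambda>\<omega>. (th \<omega>, vth \<omega>))"
  interpret prob_space M
    by (rule assms)
  have pair_meas: "(\<lambda>\<omega>. (th \<omega>, vth \<omega>)) \<in> borel_measurable M"
    using assms(5,6) by (intro borel_measurable_Pair)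
  have monom_int: "integrable M (\<lambda>\<omega>. th \<omega> ^ k1 * vth \<omega> ^ k2)" for k1 k2
  proof (rule integrable_const_bound[where B = 1])
    show "AE \<omega> in M. norm (th \<omega> ^ k1 * vth \<omega> ^ k2) \<le> 1"
      using assms(7,8) by (intro AE_I2) (simp add: norm_mult norm_power)
    show "(\<lambda>\<omega>. th \<omega> ^ k1 * vth \<omega> ^ k2) \<in> borel_measurable M"
      using assms(5,6) by measurable
  qed
  have D_int: "integrable ?D (monom2 k)" for k
    using monom_int by (simp add: integrable_distr_eq[OF pair_meas] monom2_def)
  have D_moment: "(\<integral>z. monom2 k z \<partial>?D) = \<alpha> (fst k) (snd k)" for k
    by (subst integral_distr[OF pair_meas]) (simp_all add: monom2_def \<alpha>_def)
  have \<alpha>_le: "norm (\<alpha> k1 k2) \<le> 1" for k1 k2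
  proof -
    have "norm (\<alpha> k1 k2) \<le> (\<integral>\<omega>. norm (th \<omega> ^ k1 * vth \<omega> ^ k2) \<partial>M)"
      unfolding \<alpha>_def by (rule integral_norm_bound)
    also have "\<dots> = (\<integral>\<omega>. 1 \<partial>M)"
      using assms(7,8) by (intro Bochner_Integration.integral_cong) (simp_all add: norm_mult norm_power)
    finally show ?thesis by (simp add: prob_space)
  qed
  have P: "P u v = (\<Sum>k\<in>K. b (fst k) (snd k) * u ^ fst k * v ^ snd k)" for u v
    by (simp add: P_def poly2_def K(2) split_beta)

  have W1: "(\<integral>\<omega>. W1 P x1 x2 (\<lambda>m. th1 m \<omega>) (\<lambda>m. vth1 m \<omega>) n (g1 \<omega>) \<partial>N1) =
        fps_nth (fps_expansion
          (\<lambda>t. \<Prod>(k1, k2)\<in>K. (1 - x1 ^ k1 * x2 ^ k2 * t) powr (- (b k1 k2 * \<alpha> k1 k2))) 0) n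
      + fps_nth (fps_expansion
          (\<lambda>t. \<Prod>(k1, k2)\<in>K. (1 + x1 ^ k1 * x2 ^ k2 * t) powr (b k1 k2 * \<alpha> k1 k2)) 0) n"
    for x1 x2
  proof -
    let ?y = "\<lambda>k. x1 ^ fst k * x2 ^ snd k" and ?b = "\<lambda>k. b (fst k) (snd k)"
      and ?\<alpha> = "\<lambda>k. \<alpha> (fst k) (snd k)"
    have "(\<integral>\<omega>. W1 P x1 x2 (\<lambda>m. th1 m \<omega>) (\<lambda>m. vth1 m \<omega>) n (g1 \<omega>) \<partial>N1) =
        (\<Sum>p\<in>carrier (alt_group n). cycle_weight (\<lambda>l. \<Sum>k\<in>K. (?b k * ?\<alpha> k) * ?y k ^ l) p {1..n}) /
        of_nat (card (carrier (alt_group n)))"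
    proof (rule expectation_randomized_class_function[OF assms(11) D_int,
          where J = "\<lambda>m l. {m}" and K = K and a = "\<lambda>k l. ?b k * ?y k ^ l"])
      show "W1 P x1 x2 (\<lambda>m. th1 m \<omega>) (\<lambda>m. vth1 m \<omega>) n p = (\<Prod>m<length (cycle_type n p).
          \<Sum>k\<in>K. ?b k * ?y k ^ (cycle_type n p ! m) * (\<Prod>i\<in>{m}. monom2 k (th1 i \<omega>, vth1 i \<omega>)))"
        for \<omega> p
        by (simp add: W1_def Let_def P monom2_def power_mult_distrib mult_ac
            flip: power_mult)
    qed (simp_all add: D_moment mult_ac)
    also note alt_group_average_cycle_weight[OF K(1) assms(10)]
    finally show ?thesis by (simp add: split_beta)
  qed

  have W2: "(\<integral>\<omega>. W2 P x1 x2 (\<lambda>p. th2 p \<omega>) (\<lambda>p. vth2 p \<omega>) n (g2 \<omega>) \<partial>N2) =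
        fps_nth (fps_expansion
          (\<lambda>t. \<Prod>(k1, k2)\<in>K. (1 - \<alpha> k1 k2 * x1 ^ k1 * x2 ^ k2 * t) powr (- b k1 k2)) 0) n
      + fps_nth (fps_expansion
          (\<lambda>t. \<Prod>(k1, k2)\<in>K. (1 + \<alpha> k1 k2 * x1 ^ k1 * x2 ^ k2 * t) powr (b k1 k2)) 0) n"
    for x1 x2
  proof -
    let ?y = "\<lambda>k. x1 ^ fst k * x2 ^ snd k" and ?b = "\<lambda>k. b (fst k) (snd k)"
      and ?y' = "\<lambda>k. \<alpha> (fst k) (snd k) * x1 ^ fst k * x2 ^ snd k"
    have "(\<integral>\<omega>. W2 P x1 x2 (\<lambda>p. th2 p \<omega>) (\<lambda>p. vth2 p \<omega>) n (g2 \<omega>) \<partial>N2) =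
        (\<Sum>p\<in>carrier (alt_group n). cycle_weight (\<lambda>l. \<Sum>k\<in>K. ?b k * ?y' k ^ l) p {1..n}) /
        of_nat (card (carrier (alt_group n)))"
    proof (rule expectation_randomized_class_function[OF assms(12) D_int,
          where J = "\<lambda>m l. {m} \<times> {..<l}" and K = K and a = "\<lambda>k l. ?b k * ?y k ^ l"])
      have prod_row: "(\<Prod>i\<in>{m} \<times> {..<l}. f i) = (\<Prod>j<l. f (m, j))"
        for m l :: nat and f :: "nat \<times> nat \<Rightarrow> complex"
        using prod.cartesian_product'[of f "{m}" "{..<l}"] by simp
      show "W2 P x1 x2 (\<lambda>p. th2 p \<omega>) (\<lambda>p. vth2 p \<omega>) n p = (\<Prod>m<length (cycle_type n p).
          \<Sum>k\<in>K. ?b k * ?y k ^ (cycle_type n p ! m) *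
            (\<Prod>i\<in>{m} \<times> {..<cycle_type n p ! m}. monom2 k (th2 i \<omega>, vth2 i \<omega>)))"
        for \<omega> p
        by (simp add: W2_def Let_def P monom2_def prod_row power_mult_distrib prod.distrib
            prod_power_distrib mult_ac flip: power_mult)
    qed (auto simp: D_moment power_mult_distrib mult_ac)
    also note alt_group_average_cycle_weight[OF K(1) assms(10)]
    finally show ?thesis by (simp add: split_beta)
  qed

  show ?thesis
    unfolding Let_def
    using W1 W2
      holomorphic3_on_powr_prod[OF K(1), of "\<lambda>_ _. - 1" "\<lambda>k1 k2. - (b k1 k2 * \<alpha> k1 k2)"]
      holomorphic3_on_powr_prod[OF K(1), of "\<lambda>_ _. 1" "\<lambda>k1 k2. b k1 k2 * \<alpha> k1 k2"]
      holomorphic3_on_powr_prod[OF K(1), of "\<lambda>k1 k2. - \<alpha> k1 k2" "\<lambda>k1 k2. - b k1 k2"]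
      holomorphic3_on_powr_prod[OF K(1), of \<alpha> b]
    by (simp add: \<alpha>_le)
qed

end
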